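(* Let $G$ be a torsion-free abelian group of finite rank $d$, not necessarily finitely generated, and let $k$ be a root-closed field. Then any $G$-graded field over $k$ is isomorphic (as a $G$-graded $k$-algebra) to the group algebra $k[G]$. Equivalently, $H^2_S(G,k^* )=0$. In particular, this is true when $k$ is algebraically closed.
   Context: The rank of $G$ is $\dim_{\mathbb{Q}}(\mathbb{Q}\otimes_{\mathbb{Z}}G)$. A field $k$ is root-closed if for every integer $n\geq 1$, every element of $k$ has an $n$-th root in $k$. A $G$-graded field over $k$ is a commutative $G$-graded ring $F=\bigoplus_{g\in G}F_g$ with $F_0=k$, $F_g\neq 0$ for all $g\in G$, in which every nonzero homogeneous element is invertible. The group algebra is $k[G]=\bigoplus_{g\in G}kx_g$ with $x_gx_h=x_{g+h}$. For an abelian group $A$ (written additively) with trivial $G$-action, $Z^2(G,A)$ is the group of functions $\varphi:G\times G\to A$ with $\varphi(g,h)-\varphi(f+g,h)+\varphi(f,g+h)-\varphi(f,g)=0$ for all $f,g,h\in G$; $B^2(G,A)\subset Z^2(G,A)$ is the subgroup of functions $(f,g)\mapsto\beta(g)-\beta(f+g)+\beta(f)$ with $\beta:G\to A$ any function. $Z^2_S(G,A)$ and $B^2_S(G,A)$ are the subgroups of those $\varphi$ in $Z^2(G,A)$, respectively $B^2(G,A)$, with $\varphi(g,h)=\varphi(h,g)$ for all $g,h$, and $H^2_S(G,A)=Z^2_S(G,A)/B^2_S(G,A)$. Here $A=k^*$ is the multiplicative group of $k$ with trivial $G$-action. *)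

theory Defs
  imports
    "HOL-Library.Poly_Mapping"
    "HOL-Computational_Algebra.Polynomial"
    "HOL-Algebra.Elementary_Groups"
begin

section \<open>Tensor products of abelian groups and the rank\<close>

text \<open>
  \<open>('a \<times> 'b) \<Rightarrow>\<^sub>0 int\<close> is the free abelian group on \<open>'a \<times> 'b\<close>, with basis
  elements \<open>frag_of (a, b)\<close>. The following is its subgroup generated by the bilinearity
  relations (closure under negation and addition follows from closure under subtraction).
\<close>

inductive_set tensor_relations :: "('a::ab_group_add \<times> 'b::ab_group_add \<Rightarrow>\<^sub>0 int) set" where
  zero: "0 \<in> tensor_relations"
| left: "frag_of (a + a', b) - frag_of (a, b) - frag_of (a', b) \<in> tensor_relations"
| right: "frag_of (a, b + b') - frag_of (a, b) - frag_of (a, b') \<in> tensor_relations"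
| diff: "x \<in> tensor_relations \<Longrightarrow> y \<in> tensor_relations \<Longrightarrow> x - y \<in> tensor_relations"

lemma tensor_relations_uminus: "x \<in> tensor_relations \<Longrightarrow> - x \<in> tensor_relations"
  using tensor_relations.diff[OF tensor_relations.zero] by force

lemma tensor_relations_add:
  "x \<in> tensor_relations \<Longrightarrow> y \<in> tensor_relations \<Longrightarrow> x + y \<in> tensor_relations"
  using tensor_relations.diff[OF _ tensor_relations_uminus] by force

quotient_type (overloaded) ('a, 'b) tensor =
  "'a::ab_group_add \<times> 'b::ab_group_add \<Rightarrow>\<^sub>0 int" / "\<lambda>x y. x - y \<in> tensor_relations"
proof (rule equivpI)
  show "reflp (\<lambda>x y. x - y \<in> (tensor_relations :: ('a \<times> 'b \<Rightarrow>\<^sub>0 int) set))"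
    by (rule reflpI) (simp add: tensor_relations.zero)
  show "symp (\<lambda>x y. x - y \<in> (tensor_relations :: ('a \<times> 'b \<Rightarrow>\<^sub>0 int) set))"
    by (rule sympI, drule tensor_relations_uminus) simp
  show "transp (\<lambda>x y. x - y \<in> (tensor_relations :: ('a \<times> 'b \<Rightarrow>\<^sub>0 int) set))"
    by (rule transpI, drule (1) tensor_relations_add) simp
qed

instantiation tensor :: (ab_group_add, ab_group_add) ab_group_add
begin

lift_definition zero_tensor :: "('a, 'b) tensor" is 0 .

lift_definition plus_tensor :: "('a, 'b) tensor \<Rightarrow> ('a, 'b) tensor \<Rightarrow> ('a, 'b) tensor" is "(+)"
  by (drule (1) tensor_relations_add) (simp add: algebra_simps)

lift_definition uminus_tensor :: "('a, 'b) tensor \<Rightarrow> ('a, 'b) tensor" is uminus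
  by (drule tensor_relations_uminus) simp

lift_definition minus_tensor :: "('a, 'b) tensor \<Rightarrow> ('a, 'b) tensor \<Rightarrow> ('a, 'b) tensor" is "(-)"
  by (drule (1) tensor_relations.diff) (simp add: algebra_simps)

instance
  by standard (transfer; simp add: algebra_simps tensor_relations.zero)+

end

lift_definition tensor_of :: "'a::ab_group_add \<Rightarrow> 'b::ab_group_add \<Rightarrow> ('a, 'b) tensor"
  is "\<lambda>a b. frag_of (a, b)" .

lemma frag_extend_tensor_relations:
  assumes "x \<in> tensor_relations"
  shows "frag_extend (\<lambda>(q, g). frag_of (c * q :: rat, g)) x \<in> tensor_relations"
  using assms
  by induction (auto simp: frag_extend_diff distrib_left intro: tensor_relations.intros)

text \<open>The action of \<open>\<rat>\<close> on \<open>\<rat> \<otimes> G\<close>, determined by \<open>c \<cdot> (q \<otimes> g) = (c q) \<otimes> g\<close>.\<close>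

lift_definition tensor_scale :: "rat \<Rightarrow> (rat, 'g::ab_group_add) tensor \<Rightarrow> (rat, 'g) tensor"
  is "\<lambda>c. frag_extend (\<lambda>(q, g). frag_of (c * q, g))"
  by (drule frag_extend_tensor_relations) (simp add: frag_extend_diff)

lemma tensor_of_add_left: "tensor_of (a + a') b = tensor_of a b + tensor_of a' b"
  by transfer (simp add: tensor_relations.left flip: diff_diff_eq)

lemma tensor_of_add_right: "tensor_of a (b + b') = tensor_of a b + tensor_of a b'"
  by transfer (simp add: tensor_relations.right flip: diff_diff_eq)

lemma tensor_scale_of: "tensor_scale c (tensor_of q g) = tensor_of (c * q) g"
  by transfer (simp add: tensor_relations.zero)

lemma tensor_scale_add_right: "tensor_scale c (x + y) = tensor_scale c x + tensor_scale c y"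
  by transfer (simp add: frag_extend_add tensor_relations.zero)

lemma tensor_scale_minus_right: "tensor_scale c (- x) = - tensor_scale c x"
  by transfer (simp add: frag_extend_minus tensor_relations.zero)

lemma tensor_induct [case_names of diff]:
  assumes of: "\<And>a b. P (tensor_of a b)"
    and diff: "\<And>x y. P x \<Longrightarrow> P y \<Longrightarrow> P (x - y)"
  shows "P x"
proof (induction x rule: tensor.abs_induct)
  case (1 y)
  show ?case
    using subset_UNIV
  proof (induction y rule: frag_induction)
    case zero
    show ?case
      using diff[OF of of, of 0 0 0 0] by (simp add: zero_tensor_def)
  next
    case (one p)
    then show ?case
      using of[of "fst p" "snd p"] by (simp add: tensor_of.abs_eq)
  next
    case (diff a b)
    then show ?case
      using assms(2) by (metis minus_tensor.abs_eq)
  qed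
qed

lemma vector_space_tensor_scale: "vector_space tensor_scale"
proof
  fix a b :: rat and x y :: "(rat, 'g::ab_group_add) tensor"
  show "tensor_scale a (x + y) = tensor_scale a x + tensor_scale a y"
    by (rule tensor_scale_add_right)
  have diff: "tensor_scale a (x - y) = tensor_scale a x - tensor_scale a y"
    for a and x y :: "(rat, 'g) tensor"
    by (metis add_uminus_conv_diff tensor_scale_add_right tensor_scale_minus_right)
  show "tensor_scale (a + b) x = tensor_scale a x + tensor_scale b x"
    by (induction x rule: tensor_induct)
      (simp_all add: tensor_scale_of tensor_of_add_left distrib_right diff algebra_simps)
  show "tensor_scale a (tensor_scale b x) = tensor_scale (a * b) x"
    by (induction x rule: tensor_induct) (simp_all add: tensor_scale_of diff mult.assoc)
  show "tensor_scale 1 x = x"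
    by (induction x rule: tensor_induct) (simp_all add: tensor_scale_of diff)
qed

definition has_finite_rank :: "'g::ab_group_add itself \<Rightarrow> bool" where
  "has_finite_rank _ \<longleftrightarrow>
     (\<exists>B :: (rat, 'g) tensor set. finite B \<and> module.span tensor_scale B = UNIV)"

text \<open>
  \<open>vector_space.dim\<close> is a natural number and is \<open>0\<close> for spaces of infinite dimension, so
  this is only meaningful together with \<^const>\<open>has_finite_rank\<close>.
\<close>

definition group_rank :: "'g::ab_group_add itself \<Rightarrow> nat" where
  "group_rank _ = vector_space.dim tensor_scale (UNIV :: (rat, 'g) tensor set)"

text \<open>The sum \<open>\<Sum>_<n. g\<close> is the multiple \<open>n \<cdot> g\<close>.\<close>

definition torsion_free :: "'g::ab_group_add itself \<Rightarrow> bool" where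
  "torsion_free _ \<longleftrightarrow> (\<forall>(n::nat) (g::'g). n > 0 \<longrightarrow> (\<Sum>_<n. g) = 0 \<longrightarrow> g = 0)"

definition root_closed :: "'k::field itself \<Rightarrow> bool" where
  "root_closed _ \<longleftrightarrow> (\<forall>n\<ge>1. \<forall>x::'k. \<exists>y. y ^ n = x)"


section \<open>Graded rings and graded fields\<close>

text \<open>
  \<open>F g\<close> is the homogeneous component of degree \<open>g\<close>. That \<open>1 \<in> F 0\<close> need not be demanded.
\<close>

locale graded_ring =
  fixes F :: "'g::ab_group_add \<Rightarrow> 'f::comm_ring_1 set"
  assumes zero_mem: "0 \<in> F g"
    and diff_mem: "x \<in> F g \<Longrightarrow> y \<in> F g \<Longrightarrow> x - y \<in> F g"
    and direct_sum: "\<exists>!c. (\<forall>g. c g \<in> F g) \<and> finite {g. c g \<noteq> 0} \<and> x = (\<Sum>g | c g \<noteq> 0. c g)"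
    and mult_mem: "x \<in> F g \<Longrightarrow> y \<in> F h \<Longrightarrow> x * y \<in> F (g + h)"

text \<open>
  The identification \<open>F\<^sub>0 = k\<close> is a ring homomorphism \<open>\<iota>\<close> with image \<open>F 0\<close>; it is injective
  since \<open>k\<close> is a field and \<open>1 \<noteq> 0\<close> in \<open>F\<close>. It also gives the \<open>k\<close>-algebra structure.
\<close>

locale graded_field = graded_ring F
  for F :: "'g::ab_group_add \<Rightarrow> 'f::comm_ring_1 set" +
  fixes \<iota> :: "'k::field \<Rightarrow> 'f"
  assumes embed_add: "\<iota> (a + b) = \<iota> a + \<iota> b"
    and embed_mult: "\<iota> (a * b) = \<iota> a * \<iota> b"
    and embed_one: "\<iota> 1 = 1"
    and range_embed: "range \<iota> = F 0"
    and nonzero_component: "F g \<noteq> {0}"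
    and homogeneous_invertible: "x \<in> F g \<Longrightarrow> x \<noteq> 0 \<Longrightarrow> \<exists>y. x * y = 1"

definition graded_algebra_iso ::
  "('g \<Rightarrow> 'f::comm_ring_1 set) \<Rightarrow> ('k \<Rightarrow> 'f) \<Rightarrow>
   ('g \<Rightarrow> 'e::comm_ring_1 set) \<Rightarrow> ('k \<Rightarrow> 'e) \<Rightarrow> ('f \<Rightarrow> 'e) \<Rightarrow> bool" where
  "graded_algebra_iso F \<iota> E \<kappa> \<phi> \<longleftrightarrow>
     bij \<phi> \<and> (\<forall>x y. \<phi> (x + y) = \<phi> x + \<phi> y) \<and> (\<forall>x y. \<phi> (x * y) = \<phi> x * \<phi> y) \<and> \<phi> 1 = 1 \<and>
     (\<forall>a. \<phi> (\<iota> a) = \<kappa> a) \<and> (\<forall>g. \<phi> ` F g = E g)"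

definition graded_algebra_isomorphic ::
  "('g \<Rightarrow> 'f::comm_ring_1 set) \<Rightarrow> ('k \<Rightarrow> 'f) \<Rightarrow>
   ('g \<Rightarrow> 'e::comm_ring_1 set) \<Rightarrow> ('k \<Rightarrow> 'e) \<Rightarrow> bool" where
  "graded_algebra_isomorphic F \<iota> E \<kappa> \<longleftrightarrow> (\<exists>\<phi>. graded_algebra_iso F \<iota> E \<kappa> \<phi>)"

text \<open>
  The ring \<open>k[G]\<close> is \<open>'g \<Rightarrow>\<^sub>0 'k\<close> with its convolution product: \<open>Poly_Mapping.single g c\<close> is
  \<open>c x\<^sub>g\<close>.
\<close>

definition group_algebra_component :: "'g::ab_group_add \<Rightarrow> ('g \<Rightarrow>\<^sub>0 'k::field) set" where
  "group_algebra_component g = range (Poly_Mapping.single g)"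

definition group_algebra_embed :: "'k::field \<Rightarrow> ('g::ab_group_add \<Rightarrow>\<^sub>0 'k)" where
  "group_algebra_embed = Poly_Mapping.single 0"

lemma single_eq_zero_iff: "Poly_Mapping.single g c = 0 \<longleftrightarrow> c = 0"
  by (metis lookup_single_eq lookup_zero single_zero)

lemma graded_field_group_algebra:
  "graded_field (group_algebra_component :: 'g::ab_group_add \<Rightarrow> ('g \<Rightarrow>\<^sub>0 'k::field) set)
     group_algebra_embed"
proof
  fix g h :: 'g and x y :: "'g \<Rightarrow>\<^sub>0 'k" and a b :: 'k
  let ?C = "group_algebra_component :: 'g \<Rightarrow> ('g \<Rightarrow>\<^sub>0 'k) set"
  show "0 \<in> ?C g"
    unfolding group_algebra_component_def by (metis rangeI single_zero)
  show "x - y \<in> ?C g" if "x \<in> ?C g" "y \<in> ?C g"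
    using that unfolding group_algebra_component_def by (auto simp flip: single_diff)
  show "x * y \<in> ?C (g + h)" if "x \<in> ?C g" "y \<in> ?C h"
    using that unfolding group_algebra_component_def by (auto simp: mult_single)
  show "group_algebra_embed (a + b) = (group_algebra_embed a + group_algebra_embed b :: 'g \<Rightarrow>\<^sub>0 'k)"
    "group_algebra_embed (a * b) = (group_algebra_embed a * group_algebra_embed b :: 'g \<Rightarrow>\<^sub>0 'k)"
    "group_algebra_embed 1 = (1 :: 'g \<Rightarrow>\<^sub>0 'k)"
    by (simp_all add: group_algebra_embed_def single_add mult_single)
  show "range group_algebra_embed = ?C 0"
    by (simp add: group_algebra_embed_def group_algebra_component_def)
  have "Poly_Mapping.single g 1 \<in> ?C g" "Poly_Mapping.single g (1 :: 'k) \<noteq> 0"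
    by (auto simp: group_algebra_component_def single_eq_zero_iff)
  then show "?C g \<noteq> {0}" by blast
  show "\<exists>y. x * y = 1" if x: "x \<in> ?C g" "x \<noteq> 0"
  proof -
    obtain c where c: "x = Poly_Mapping.single g c"
      using x(1) by (auto simp: group_algebra_component_def)
    have "c \<noteq> 0" using c x(2) by auto
    then have "x * Poly_Mapping.single (- g) (inverse c) = 1"
      by (simp add: c mult_single)
    then show ?thesis by blast
  qed
  show "\<exists>!c. (\<forall>g. c g \<in> ?C g) \<and> finite {g. c g \<noteq> 0} \<and> x = (\<Sum>g | c g \<noteq> 0. c g)"
  proof (rule ex1I)
    let ?c = "\<lambda>g. Poly_Mapping.single g (Poly_Mapping.lookup x g)"
    have eq: "{g. ?c g \<noteq> 0} = Poly_Mapping.keys x"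
      by (auto simp: single_eq_zero_iff in_keys_iff)
    have "x = (\<Sum>g\<in>Poly_Mapping.keys x. ?c g)"
      by (rule poly_mapping_eqI)
        (simp add: lookup_sum lookup_single when_def in_keys_iff)
    then show "(\<forall>g. ?c g \<in> ?C g) \<and> finite {g. ?c g \<noteq> 0} \<and> x = (\<Sum>g | ?c g \<noteq> 0. ?c g)"
      unfolding eq by (auto simp: group_algebra_component_def)
  next
    fix c
    assume c: "(\<forall>g. c g \<in> ?C g) \<and> finite {g. c g \<noteq> 0} \<and> x = (\<Sum>g | c g \<noteq> 0. c g)"
    then have "\<forall>g. \<exists>a. c g = Poly_Mapping.single g a"
      by (auto simp: group_algebra_component_def)
    then obtain a where a: "\<And>g. c g = Poly_Mapping.single g (a g)" by metis
    have fin: "finite {g. a g \<noteq> 0}"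
      using c by (simp add: a single_eq_zero_iff)
    have "x = (\<Sum>g | a g \<noteq> 0. Poly_Mapping.single g (a g))"
      using c by (simp add: a single_eq_zero_iff)
    then have "Poly_Mapping.lookup x g = a g" for g
      using fin by (simp add: lookup_sum lookup_single when_def)
    then show "c = (\<lambda>g. Poly_Mapping.single g (Poly_Mapping.lookup x g))"
      by (simp add: a fun_eq_iff)
  qed
qed


section \<open>Symmetric second cohomology\<close>

text \<open>
  The coefficient group \<open>A\<close> has trivial \<open>G\<close>-action and is written multiplicatively, as
  usual in HOL-Algebra.
\<close>

definition Z2 :: "('a, 'm) monoid_scheme \<Rightarrow> ('g::ab_group_add \<Rightarrow> 'g \<Rightarrow> 'a) set" where
  "Z2 A = {\<phi>. (\<forall>f g. \<phi> f g \<in> carrier A) \<and>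
     (\<forall>f g h. \<phi> g h \<otimes>\<^bsub>A\<^esub> inv\<^bsub>A\<^esub> \<phi> (f + g) h \<otimes>\<^bsub>A\<^esub> \<phi> f (g + h) \<otimes>\<^bsub>A\<^esub> inv\<^bsub>A\<^esub> \<phi> f g = \<one>\<^bsub>A\<^esub>)}"

definition B2 :: "('a, 'm) monoid_scheme \<Rightarrow> ('g::ab_group_add \<Rightarrow> 'g \<Rightarrow> 'a) set" where
  "B2 A = {\<phi>. \<exists>\<beta>. (\<forall>g. \<beta> g \<in> carrier A) \<and>
     \<phi> = (\<lambda>f g. \<beta> g \<otimes>\<^bsub>A\<^esub> inv\<^bsub>A\<^esub> \<beta> (f + g) \<otimes>\<^bsub>A\<^esub> \<beta> f)}"

definition Z2_S :: "('a, 'm) monoid_scheme \<Rightarrow> ('g::ab_group_add \<Rightarrow> 'g \<Rightarrow> 'a) set" where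
  "Z2_S A = {\<phi> \<in> Z2 A. \<forall>g h. \<phi> g h = \<phi> h g}"

definition B2_S :: "('a, 'm) monoid_scheme \<Rightarrow> ('g::ab_group_add \<Rightarrow> 'g \<Rightarrow> 'a) set" where
  "B2_S A = {\<phi> \<in> B2 A. \<forall>g h. \<phi> g h = \<phi> h g}"

definition Z2_S_group :: "('a, 'm) monoid_scheme \<Rightarrow> ('g::ab_group_add \<Rightarrow> 'g \<Rightarrow> 'a) monoid" where
  "Z2_S_group A = \<lparr>carrier = Z2_S A, monoid.mult = (\<lambda>\<phi> \<psi> f g. \<phi> f g \<otimes>\<^bsub>A\<^esub> \<psi> f g), one = (\<lambda>f g. \<one>\<^bsub>A\<^esub>)\<rparr>"

definition H2_S :: "('a, 'm) monoid_scheme \<Rightarrow> ('g::ab_group_add \<Rightarrow> 'g \<Rightarrow> 'a) set monoid" where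
  "H2_S A = Z2_S_group A Mod B2_S A"

definition field_units :: "'k::field monoid" where
  "field_units = \<lparr>carrier = - {0}, monoid.mult = (*), one = 1\<rparr>"

lemma comm_group_field_units: "comm_group (field_units :: 'k::field monoid)"
proof (rule comm_groupI)
  fix x :: 'k
  assume "x \<in> carrier field_units"
  then show "\<exists>y\<in>carrier field_units. y \<otimes>\<^bsub>field_units\<^esub> x = \<one>\<^bsub>field_units\<^esub>"
    by (intro bexI[of _ "inverse x"]) (auto simp: field_units_def)
qed (auto simp: field_units_def mult_ac)

end

theory Submission
  imports Defs
begin

text \<open>
  A divisible subgroup of an abelian group is a direct factor. For a root-closed field the group
  \<open>k\<^sup>*\<close> is divisible, so the abelian extension of \<open>G\<close> by \<open>k\<^sup>*\<close> given by a symmetric cocycle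
  splits, and a splitting exhibits the cocycle as a coboundary. Nonzero elements \<open>u\<^sub>g \<in> F\<^sub>g\<close> of a
  graded field multiply up to such a cocycle, so they can be rescaled to a multiplicative family
  \<open>s\<^sub>g\<close>, and \<open>x\<^sub>g \<mapsto> s\<^sub>g\<close> is then the isomorphism from \<open>k[G]\<close> onto \<open>F\<close>.
\<close>

section \<open>Divisible subgroups of abelian groups are direct factors\<close>

text \<open>Two elements of the union lie in two comparable members, hence in a common one, where
  their product is formed. This is the upper bound for Zorn's lemma.\<close>

lemma (in group) subgroup_Union_chain:
  assumes "\<C> \<noteq> {}" "subset.chain {H. subgroup H G} \<C>"
  shows "subgroup (\<Union>\<C>) G"
proof (rule subgroupI)
  have sub: "subgroup H G" if "H \<in> \<C>" for H
    using assms(2) that by (auto simp: subset.chain_def)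
  show "\<Union>\<C> \<subseteq> carrier G"
    using subgroup.subset[OF sub] by blast
  show "\<Union>\<C> \<noteq> {}"
    using assms(1) subgroup.one_closed[OF sub] by blast
  show "inv a \<in> \<Union>\<C>" if "a \<in> \<Union>\<C>" for a
    using that subgroup.m_inv_closed[OF sub] by auto
  show "a \<otimes> b \<in> \<Union>\<C>" if ab: "a \<in> \<Union>\<C>" "b \<in> \<Union>\<C>" for a b
  proof -
    obtain H K where "H \<in> \<C>" "K \<in> \<C>" "a \<in> H" "b \<in> K"
      using ab by blast
    moreover from this have "H \<subseteq> K \<or> K \<subseteq> H"
      using assms(2) by (auto simp: subset.chain_def)
    ultimately obtain L where "L \<in> \<C>" "a \<in> L" "b \<in> L"
      by blast
    then show ?thesis
      using subgroup.m_closed[OF sub] by blast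
  qed
qed

text \<open>
  The element \<open>v\<close> is \<open>u\<close> divided by an \<open>n\<close>-th root of the \<open>A\<close>-component of \<open>u\<^sup>n\<close>, for the
  least \<open>n > 0\<close> with \<open>u\<^sup>n \<in> R A\<close>.
\<close>

lemma (in comm_group) divisible_coset_representative:
  assumes A: "subgroup A G" and R: "subgroup R G"
    and div: "\<And>(n::nat) a. n > 0 \<Longrightarrow> a \<in> A \<Longrightarrow> \<exists>b\<in>A. b [^] n = a"
    and u: "u \<in> carrier G"
  obtains v b where "v \<in> carrier G" "b \<in> A" "u = v \<otimes> b"
    and "\<And>m::int. v [^] m \<in> R <#> A \<Longrightarrow> v [^] m \<in> R"
proof -
  have RA: "subgroup (R <#> A) G"
    using R A by (rule mult_subgroups)
  have Ac: "a \<in> carrier G" if "a \<in> A" for a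
    using that by (rule subgroup.mem_carrier[OF A])
  show thesis
  proof (cases "\<exists>n::nat. n > 0 \<and> u [^] n \<in> R <#> A")
    case False
    \<comment> \<open>Here \<open>u\<close> has infinite order modulo \<open>R <#> A\<close>: no
      power except the zeroth lies there, so \<open>v = u\<close> and \<open>b = \<one>\<close>
      serve.\<close>
    have "m = 0" if "u [^] m \<in> R <#> A" for m :: int
    proof (rule ccontr)
      assume "m \<noteq> 0"
      moreover have "u [^] nat \<bar>m\<bar> \<in> R <#> A"
      proof (cases "m \<ge> 0")
        case True
        then have "u [^] nat \<bar>m\<bar> = u [^] m"
          by (metis abs_of_nonneg int_nat_eq int_pow_int)
        then show ?thesis
          using that by metis
      next
        case False
        then have "u [^] nat \<bar>m\<bar> = inv (u [^] m)"
          using u by (metis abs_of_nonpos int_nat_eq int_pow_int int_pow_neg linorder_linear neg_0_le_iff_le)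
        then show ?thesis
          using subgroup.m_inv_closed[OF RA that] by metis
      qed
      ultimately show False
        using False by (metis zero_less_abs_iff zero_less_nat_eq)
    qed
    then have "u [^] m \<in> R" if "u [^] m \<in> R <#> A" for m :: int
      using that subgroup.one_closed[OF R] int_pow_0 by metis
    then show thesis
      using that[of u "\<one>"] u subgroup.one_closed[OF A] by simp
  next
    case True
    define n where "n = (LEAST n::nat. n > 0 \<and> u [^] n \<in> R <#> A)"
    have n: "n > 0" "u [^] n \<in> R <#> A"
      using LeastI_ex[OF True] by (auto simp: n_def)
    have min: "n \<le> k" if "k > 0" "u [^] k \<in> R <#> A" for k
      unfolding n_def using that by (intro Least_le) auto
    obtain r a where ra: "r \<in> R" "a \<in> A" "u [^] n = r \<otimes> a"
      using n(2) by (auto simp: set_mult_def)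
    obtain b where b: "b \<in> A" "b [^] n = a"
      using div n(1) ra(2) by blast
    define v where "v = u \<otimes> inv b"
    have v: "v \<in> carrier G" "u = v \<otimes> b"
      using u b Ac by (auto simp: v_def m_assoc)
    have "r \<in> carrier G"
      using ra subgroup.mem_carrier[OF R] by blast
    then have "v [^] n = r"
      using u b ra Ac by (simp add: v_def nat_pow_distrib nat_pow_inv m_assoc)
    then have vn: "v [^] n \<in> R"
      using ra by simp
    \<comment> \<open>Since \<open>b\<close> lies in \<open>A\<close>, membership of
      \<open>v [^] m\<close> in \<open>R <#> A\<close> passes to \<open>u [^] m\<close>. Dividing
      \<open>m\<close> by \<open>n\<close> leaves a remainder that the minimality of
      \<open>n\<close> forces to be 0, so \<open>v [^] m\<close> is a power of
      \<open>v [^] n = r\<close>.\<close>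
    have "v [^] m \<in> R" if m: "v [^] m \<in> R <#> A" for m :: int
    proof -
      have bm: "b [^] m \<in> R <#> A"
        using subgroup.one_closed[OF R] subgroup_int_pow_closed[OF A b(1), of m] b Ac
        by (force simp: set_mult_def)
      have um: "u [^] m \<in> R <#> A"
        using subgroup.m_closed[OF RA m bm] v b Ac by (simp add: int_pow_distrib)
      have "(u [^] n) [^] (m div int n) \<in> R <#> A"
        using subgroup_int_pow_closed[OF RA n(2)] .
      then have "u [^] (int n * (m div int n)) \<in> R <#> A"
        using u int_pow_pow[OF u, of "int n" "m div int n"] by (simp add: int_pow_int)
      moreover have "u [^] (m mod int n) = u [^] m \<otimes> inv (u [^] (int n * (m div int n)))"
        using u by (metis int_pow_diff minus_mult_div_eq_mod)
      ultimately have "u [^] (m mod int n) \<in> R <#> A"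
        using um RA by (simp add: subgroup.m_closed subgroup.m_inv_closed)
      moreover have "m mod int n = int (nat (m mod int n))"
        using n(1) by simp
      ultimately have mem: "u [^] nat (m mod int n) \<in> R <#> A"
        by (metis int_pow_int)
      have "nat (m mod int n) < n"
        using n(1) by (simp add: nat_less_iff)
      then have "m mod int n = 0"
        using min[OF _ mem] n(1) by (metis linorder_not_less neq0_conv nat_eq_iff2 pos_mod_sign of_nat_0_less_iff of_nat_0)
      then obtain q where "m = int n * q"
        by (auto elim: dvdE)
      then show ?thesis
        using subgroup_int_pow_closed[OF R vn, of q] int_pow_pow[OF v(1), of "int n" q]
        by (simp add: int_pow_int)
    qed
    then show thesis
      using that v b by blast
  qed
qed

text \<open>A subgroup that is maximal among those meeting \<open>A\<close> trivially is a complement of \<open>A\<close>.\<close>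

theorem (in comm_group) divisible_subgroup_complement:
  assumes A: "subgroup A G"
    and div: "\<And>(n::nat) a. n > 0 \<Longrightarrow> a \<in> A \<Longrightarrow> \<exists>b\<in>A. b [^] n = a"
  obtains R where "subgroup R G" "R \<inter> A = {\<one>}" "R <#> A = carrier G"
proof -
  define \<A> where "\<A> = {R. subgroup R G \<and> R \<inter> A \<subseteq> {\<one>}}"
  have "\<exists>R\<in>\<A>. \<forall>X\<in>\<A>. R \<subseteq> X \<longrightarrow> X = R"
  proof (rule subset_Zorn_nonempty)
    show "\<A> \<noteq> {}"
      using triv_subgroup by (auto simp: \<A>_def)
    show "\<Union>\<C> \<in> \<A>" if "\<C> \<noteq> {}" "subset.chain \<A> \<C>" for \<C>
    proof -
      have "subset.chain {H. subgroup H G} \<C>"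
        using that(2) by (auto simp: subset.chain_def \<A>_def)
      then show ?thesis
        using subgroup_Union_chain that by (auto simp: subset.chain_def \<A>_def)
    qed
  qed
  then obtain R where R: "subgroup R G" "R \<inter> A \<subseteq> {\<one>}"
    and max: "\<And>X. subgroup X G \<Longrightarrow> X \<inter> A \<subseteq> {\<one>} \<Longrightarrow> R \<subseteq> X \<Longrightarrow> X = R"
    by (auto simp: \<A>_def)
  have "u \<in> R <#> A" if u: "u \<in> carrier G" for u
  proof -
    obtain v b where v: "v \<in> carrier G" "b \<in> A" "u = v \<otimes> b"
      and vm: "\<And>m::int. v [^] m \<in> R <#> A \<Longrightarrow> v [^] m \<in> R"
      using divisible_coset_representative[OF A R(1) div u] by blast
    \<comment> \<open>Adjoining the cyclic group generated by \<open>v\<close> keeps the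
      intersection with \<open>A\<close> trivial, so by maximality \<open>v\<close> is already in
      \<open>R\<close>, and then \<open>u = v \<otimes> b\<close> is in
      \<open>R <#> A\<close>.\<close>
    define V where "V = range (\<lambda>m::int. v [^] m)"
    have V: "subgroup V G"
    proof (rule subgroupI)
      show "inv a \<in> V" if "a \<in> V" for a
        using that v(1) by (auto simp: V_def simp flip: int_pow_neg)
      show "a \<otimes> b \<in> V" if "a \<in> V" "b \<in> V" for a b
        using that v(1) by (auto simp: V_def simp flip: int_pow_mult)
    qed (use v in \<open>auto simp: V_def\<close>)
    have "R <#> V = R"
    proof (rule max)
      show "subgroup (R <#> V) G"
        using R(1) V by (rule mult_subgroups)
      show "R \<subseteq> R <#> V"
      proof
        fix r assume "r \<in> R"
        then show "r \<in> R <#> V"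
          using subgroup.one_closed[OF V] subgroup.mem_carrier[OF R(1)]
          by (force simp: set_mult_def)
      qed
      show "(R <#> V) \<inter> A \<subseteq> {\<one>}"
      proof
        fix a assume a: "a \<in> (R <#> V) \<inter> A"
        then obtain r m where rm: "r \<in> R" "a = r \<otimes> v [^] (m::int)"
          by (auto simp: set_mult_def V_def)
        have carr: "r \<in> carrier G" "a \<in> carrier G"
          using rm(1) a subgroup.mem_carrier[OF R(1)] subgroup.mem_carrier[OF A] by auto
        \<comment> \<open>This puts a power of \<open>v\<close> into \<open>R <#> A\<close>, hence
          into \<open>R\<close> by the choice of \<open>v\<close>; so \<open>a\<close> lies in both
          \<open>R\<close> and \<open>A\<close>.\<close>
        then have "v [^] m = inv r \<otimes> a"
          using rm v by (simp add: m_assoc[symmetric])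
        then have "v [^] m \<in> R <#> A"
          using rm a subgroup.m_inv_closed[OF R(1)] by (auto simp: set_mult_def)
        then have "v [^] m \<in> R"
          by (rule vm)
        then have "a \<in> R"
          using rm subgroup.m_closed[OF R(1)] by simp
        then show "a \<in> {\<one>}"
          using a R(2) by blast
      qed
    qed
    moreover have "v \<in> R <#> V"
      using subgroup.one_closed[OF R(1)] v(1) int_pow_1[OF v(1)] unfolding set_mult_def V_def
      by (metis (no_types, lifting) UN_I l_one rangeI singletonI)
    ultimately show ?thesis
      using v by (auto simp: set_mult_def)
  qed
  then have "R <#> A = carrier G"
    using setmult_subset_G[OF subgroup.subset[OF R(1)] subgroup.subset[OF A]] by blast
  moreover have "R \<inter> A = {\<one>}"
    using R(2) subgroup.one_closed[OF R(1)] subgroup.one_closed[OF A] by blast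
  ultimately show thesis
    using that R(1) by blast
qed

section \<open>Cocycle and coboundary conditions without inverses\<close>

text \<open>Clearing inverses turns the cocycle condition into the associativity law of the twisted
  product on pairs used for the extension below.\<close>

lemma (in comm_group) Z2_iff:
  "\<phi> \<in> Z2 G \<longleftrightarrow> (\<forall>f g. \<phi> f g \<in> carrier G) \<and>
     (\<forall>f g h. \<phi> f g \<otimes> \<phi> (f + g) h = \<phi> g h \<otimes> \<phi> f (g + h))"
proof -
  have "a \<otimes> inv b \<otimes> c \<otimes> inv d = \<one> \<longleftrightarrow> d \<otimes> b = a \<otimes> c"
    if "a \<in> carrier G" "b \<in> carrier G" "c \<in> carrier G" "d \<in> carrier G" for a b c d
  proof -
    have "a \<otimes> inv b \<otimes> c \<otimes> inv d = (a \<otimes> c) \<otimes> inv (d \<otimes> b)"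
      using that by (simp add: inv_mult m_ac)
    then show ?thesis
      using that by (simp add: inv_solve_right' eq_commute)
  qed
  then show ?thesis
    unfolding Z2_def by auto
qed

text \<open>In this form \<open>\<phi>\<close> is the defect of multiplicativity of
  \<open>\<beta>\<close>. The values of \<open>\<phi>\<close> have to be placed in the carrier
  separately, because inverses can be cleared only there.\<close>

lemma (in comm_group) B2_iff:
  "\<phi> \<in> B2 G \<longleftrightarrow> (\<forall>f g. \<phi> f g \<in> carrier G) \<and>
     (\<exists>\<beta>. (\<forall>g. \<beta> g \<in> carrier G) \<and> (\<forall>f g. \<phi> f g \<otimes> \<beta> (f + g) = \<beta> f \<otimes> \<beta> g))"
proof -
  have eq: "x = b \<otimes> inv c \<otimes> a \<longleftrightarrow> x \<otimes> c = a \<otimes> b"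
    if "x \<in> carrier G" "a \<in> carrier G" "b \<in> carrier G" "c \<in> carrier G" for x a b c
  proof -
    have "b \<otimes> inv c \<otimes> a = (a \<otimes> b) \<otimes> inv c"
      using that by (simp add: m_ac)
    then show ?thesis
      using that inv_solve_right[of x "a \<otimes> b" c] by (metis m_closed)
  qed
  show ?thesis
  proof
    assume "\<phi> \<in> B2 G"
    then obtain \<beta> where \<beta>: "\<And>g. \<beta> g \<in> carrier G"
      "\<And>f g. \<phi> f g = \<beta> g \<otimes> inv \<beta> (f + g) \<otimes> \<beta> f"
      by (auto simp: B2_def)
    then have c: "\<phi> f g \<in> carrier G" for f g
      by simp
    have "\<phi> f g \<otimes> \<beta> (f + g) = \<beta> f \<otimes> \<beta> g" for f g
      using \<beta> c eq by blast
    then show "(\<forall>f g. \<phi> f g \<in> carrier G) \<and>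
        (\<exists>\<beta>. (\<forall>g. \<beta> g \<in> carrier G) \<and> (\<forall>f g. \<phi> f g \<otimes> \<beta> (f + g) = \<beta> f \<otimes> \<beta> g))"
      using \<beta>(1) c by blast
  next
    assume "(\<forall>f g. \<phi> f g \<in> carrier G) \<and>
        (\<exists>\<beta>. (\<forall>g. \<beta> g \<in> carrier G) \<and> (\<forall>f g. \<phi> f g \<otimes> \<beta> (f + g) = \<beta> f \<otimes> \<beta> g))"
    then obtain \<beta> where "\<And>f g. \<phi> f g \<in> carrier G" "\<And>g. \<beta> g \<in> carrier G"
      "\<And>f g. \<phi> f g \<otimes> \<beta> (f + g) = \<beta> f \<otimes> \<beta> g"
      by blast
    then have "\<phi> = (\<lambda>f g. \<beta> g \<otimes> inv \<beta> (f + g) \<otimes> \<beta> f)"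
      by (intro ext eq[THEN iffD2])
    then show "\<phi> \<in> B2 G"
      unfolding B2_def using \<open>\<And>g. \<beta> g \<in> carrier G\<close> by blast
  qed
qed

text \<open>After multiplication by \<open>\<beta> (f + g + h)\<close> both sides of the cocycle
  identity become the product of \<open>\<beta> f\<close>, \<open>\<beta> g\<close> and
  \<open>\<beta> h\<close>.\<close>

lemma (in comm_group) B2_subset_Z2: "B2 G \<subseteq> Z2 G"
proof
  fix \<phi> :: "'h::ab_group_add \<Rightarrow> 'h \<Rightarrow> 'a"
  assume "\<phi> \<in> B2 G"
  then obtain \<beta> where c [simp]: "\<And>f g. \<phi> f g \<in> carrier G" "\<And>g. \<beta> g \<in> carrier G"
    and \<beta>: "\<And>f g. \<phi> f g \<otimes> \<beta> (f + g) = \<beta> f \<otimes> \<beta> g"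
    unfolding B2_iff by blast
  have "\<phi> f g \<otimes> \<phi> (f + g) h = \<phi> g h \<otimes> \<phi> f (g + h)" for f g h
  proof -
    have "(\<phi> f g \<otimes> \<phi> (f + g) h) \<otimes> \<beta> (f + g + h) = \<phi> f g \<otimes> (\<phi> (f + g) h \<otimes> \<beta> (f + g + h))"
      by (simp add: m_assoc)
    also have "\<dots> = (\<phi> f g \<otimes> \<beta> (f + g)) \<otimes> \<beta> h"
      unfolding \<beta>[of "f + g"] by (simp add: m_assoc)
    also have "\<dots> = (\<beta> g \<otimes> \<beta> h) \<otimes> \<beta> f"
      unfolding \<beta> by (simp add: m_ac)
    also have "\<dots> = \<phi> g h \<otimes> (\<beta> f \<otimes> \<beta> (g + h))"
      unfolding \<beta>[of g h, symmetric] by (simp add: m_ac)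
    also have "\<dots> = \<phi> g h \<otimes> (\<phi> f (g + h) \<otimes> \<beta> (f + (g + h)))"
      by (simp only: \<beta>)
    also have "\<dots> = (\<phi> g h \<otimes> \<phi> f (g + h)) \<otimes> \<beta> (f + g + h)"
      by (simp add: m_assoc add.assoc)
    finally show ?thesis
      by simp
  qed
  then show "\<phi> \<in> Z2 G"
    by (simp add: Z2_iff)
qed

section \<open>The abelian extension defined by a symmetric cocycle\<close>

locale symmetric_cocycle = comm_group A for A (structure) +
  fixes \<phi> :: "'g::ab_group_add \<Rightarrow> 'g \<Rightarrow> 'a"
  assumes Z2_S: "\<phi> \<in> Z2_S A"
begin

lemma closed [simp]: "\<phi> f g \<in> carrier A"
  using Z2_S by (auto simp: Z2_S_def Z2_iff)

lemma symmetric: "\<phi> f g = \<phi> g f"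
  using Z2_S by (auto simp: Z2_S_def)

lemma cocycle: "\<phi> f g \<otimes> \<phi> (f + g) h = \<phi> g h \<otimes> \<phi> f (g + h)"
  using Z2_S unfolding Z2_S_def Z2_iff by blast

text \<open>The cocycle identity at \<open>0, 0, g\<close> has the factor \<open>\<phi> 0 g\<close>
  on both sides. The constant value found this way makes one element neutral for all
  degrees.\<close>

lemma zero_left: "\<phi> 0 g = \<phi> 0 0"
  using cocycle[of 0 0 g] by simp

text \<open>
  As \<open>\<phi>\<close> need not be normalised, the neutral element is \<open>(\<phi>(0,0)\<^sup>-\<^sup>1, 0)\<close>, and \<open>embed\<close>
  below carries the corresponding factor.
\<close>

definition extension :: "('a \<times> 'g) monoid" where
  "extension = \<lparr>carrier = carrier A \<times> UNIV,
     monoid.mult = (\<lambda>(a, f) (b, g). (a \<otimes> b \<otimes> \<phi> f g, f + g)), one = (inv \<phi> 0 0, 0)\<rparr>"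

lemma extension_simps [simp]:
  "carrier extension = carrier A \<times> UNIV"
  "(a, f) \<otimes>\<^bsub>extension\<^esub> (b, g) = (a \<otimes> b \<otimes> \<phi> f g, f + g)"
  "\<one>\<^bsub>extension\<^esub> = (inv \<phi> 0 0, 0)"
  by (simp_all add: extension_def)

text \<open>Associativity is the cocycle identity, and commutativity is the symmetry of
  \<open>\<phi>\<close>.\<close>

lemma comm_group_extension: "comm_group extension"
proof (rule comm_groupI)
  show "x \<otimes>\<^bsub>extension\<^esub> y \<otimes>\<^bsub>extension\<^esub> z = x \<otimes>\<^bsub>extension\<^esub> (y \<otimes>\<^bsub>extension\<^esub> z)"
    if xyz: "x \<in> carrier extension" "y \<in> carrier extension" "z \<in> carrier extension" for x y z
  proof -
    obtain a f b g c h where x: "x = (a, f)" "y = (b, g)" "z = (c, h)"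
      by (metis surj_pair)
    have [simp]: "a \<in> carrier A" "b \<in> carrier A" "c \<in> carrier A"
      using xyz x by auto
    have "a \<otimes> b \<otimes> \<phi> f g \<otimes> c \<otimes> \<phi> (f + g) h = a \<otimes> b \<otimes> c \<otimes> (\<phi> f g \<otimes> \<phi> (f + g) h)"
      by (simp add: m_ac)
    also have "\<dots> = a \<otimes> b \<otimes> c \<otimes> (\<phi> g h \<otimes> \<phi> f (g + h))"
      by (simp only: cocycle)
    also have "\<dots> = a \<otimes> (b \<otimes> c \<otimes> \<phi> g h) \<otimes> \<phi> f (g + h)"
      by (simp add: m_ac)
    finally show ?thesis
      by (simp add: x add.assoc)
  qed
  show "x \<otimes>\<^bsub>extension\<^esub> y = y \<otimes>\<^bsub>extension\<^esub> x"
    if "x \<in> carrier extension" "y \<in> carrier extension" for x y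
    using that by (auto simp: m_comm add.commute symmetric)
  show "\<one>\<^bsub>extension\<^esub> \<otimes>\<^bsub>extension\<^esub> x = x" if "x \<in> carrier extension" for x
  proof -
    obtain a f where x: "x = (a, f)"
      by (cases x)
    with that have a: "a \<in> carrier A"
      by simp
    have "inv \<phi> 0 0 \<otimes> a \<otimes> \<phi> 0 0 = a"
      using a m_comm[of "inv \<phi> 0 0" a] by (simp add: m_assoc)
    then show ?thesis
      using x a zero_left[of f] by simp
  qed
  show "\<exists>y\<in>carrier extension. y \<otimes>\<^bsub>extension\<^esub> x = \<one>\<^bsub>extension\<^esub>"
    if "x \<in> carrier extension" for x
  proof -
    obtain a f where x: "x = (a, f)"
      by (cases x)
    with that have a: "a \<in> carrier A"
      by simp
    \<comment> \<open>Solves \<open>b \<otimes> a \<otimes> \<phi> (- f) f = inv \<phi> 0 0\<close>,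
      which makes \<open>(b, - f)\<close> the inverse of \<open>(a, f)\<close>.\<close>
    define b where "b = inv \<phi> 0 0 \<otimes> inv (a \<otimes> \<phi> (- f) f)"
    have "b \<otimes> a \<otimes> \<phi> (- f) f = inv \<phi> 0 0 \<otimes> (inv (a \<otimes> \<phi> (- f) f) \<otimes> (a \<otimes> \<phi> (- f) f))"
      using a by (simp add: b_def m_assoc del: l_inv)
    also have "\<dots> = inv \<phi> 0 0"
      using a by simp
    finally show ?thesis
      using x a by (intro bexI[of _ "(b, - f)"]) (auto simp: b_def)
  qed
qed auto

definition embed :: "'a \<Rightarrow> 'a \<times> 'g" where
  "embed a = (a \<otimes> inv \<phi> 0 0, 0)"

lemma embed_hom: "embed \<in> hom A extension"
proof (rule homI)
  fix a b assume [simp]: "a \<in> carrier A" "b \<in> carrier A"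
  have "a \<otimes> c \<otimes> (b \<otimes> c) \<otimes> d = a \<otimes> b \<otimes> c \<otimes> (c \<otimes> d)"
    if "c \<in> carrier A" "d \<in> carrier A" for c d
    using that by (simp add: m_ac)
  from this[of "inv \<phi> 0 0" "\<phi> 0 0"]
  have "a \<otimes> inv \<phi> 0 0 \<otimes> (b \<otimes> inv \<phi> 0 0) \<otimes> \<phi> 0 0 = a \<otimes> b \<otimes> inv \<phi> 0 0"
    by simp
  then show "embed (a \<otimes> b) = embed a \<otimes>\<^bsub>extension\<^esub> embed b"
    by (simp add: embed_def)
qed (simp add: embed_def)

text \<open>The image of \<open>embed\<close> acts by translation on the first coordinate, so its
  cosets are the fibres of the projection to the second one.\<close>

lemma embed_mult:
  assumes "a \<in> carrier A" "b \<in> carrier A"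
  shows "(b, g) \<otimes>\<^bsub>extension\<^esub> embed a = (b \<otimes> a, g)"
proof -
  have "b \<otimes> (a \<otimes> inv \<phi> 0 0) \<otimes> \<phi> 0 0 = b \<otimes> a \<otimes> (inv \<phi> 0 0 \<otimes> \<phi> 0 0)"
    using assms by (simp add: m_ac del: l_inv)
  then show ?thesis
    using assms symmetric[of g 0] zero_left[of g] by (simp add: embed_def)
qed

text \<open>A complement of the image of \<open>A\<close> in the extension is the graph of a function \<open>\<beta>\<close>.\<close>

lemma divisible_imp_B2_S:
  assumes div: "\<And>(n::nat) a. n > 0 \<Longrightarrow> a \<in> carrier A \<Longrightarrow> \<exists>b\<in>carrier A. b [^] n = a"
  shows "\<phi> \<in> B2_S A"
proof -
  interpret E: comm_group extension
    by (rule comm_group_extension)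
  interpret i: group_hom A extension embed
    by unfold_locales (rule embed_hom)
  \<comment> \<open>Divisibility passes to homomorphic images.\<close>
  have "\<exists>b\<in>embed ` carrier A. b [^]\<^bsub>extension\<^esub> n = a"
    if n: "n > 0" and a: "a \<in> embed ` carrier A" for n :: nat and a
  proof -
    obtain c where c: "c \<in> carrier A" "a = embed c"
      using a by blast
    obtain b where "b \<in> carrier A" "b [^] n = c"
      using div[OF n c(1)] by blast
    then show ?thesis
      using c(2) i.hom_nat_pow[of b n] by (metis imageI)
  qed
  then obtain R where R: "subgroup R extension"
    and disj: "R \<inter> embed ` carrier A = {\<one>\<^bsub>extension\<^esub>}"
    and total: "R <#>\<^bsub>extension\<^esub> embed ` carrier A = carrier extension"
    using E.divisible_subgroup_complement[OF i.img_is_subgroup] by metis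
  have Rc: "a \<in> carrier A" if "(a, g) \<in> R" for a g
    using subgroup.mem_carrier[OF R that] by simp
  have "\<exists>b. (b, g) \<in> R" for g
  proof -
    have "(\<one>, g) \<in> R <#>\<^bsub>extension\<^esub> embed ` carrier A"
      by (simp add: total)
    then obtain r a where "r \<in> R" "a \<in> carrier A" "(\<one>, g) = r \<otimes>\<^bsub>extension\<^esub> embed a"
      by (auto simp: set_mult_def)
    moreover obtain b f where "r = (b, f)"
      by (cases r)
    ultimately show ?thesis
      using Rc by (auto simp: embed_mult)
  qed
  then obtain \<gamma> where \<gamma>: "\<And>g. (\<gamma> g, g) \<in> R"
    by metis
  have \<gamma>c [simp]: "\<gamma> g \<in> carrier A" for g
    using Rc \<gamma> by blast
  \<comment> \<open>Two elements of \<open>R\<close> in the same fibre differ by an element of the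
    image of \<open>embed\<close>, which also lies in \<open>R\<close> and is therefore
    neutral.\<close>
  have unique: "a = b" if ab: "(a, g) \<in> R" "(b, g) \<in> R" for a b g
  proof -
    have [simp]: "a \<in> carrier A" "b \<in> carrier A"
      using Rc ab by auto
    obtain c where c: "c \<in> carrier A" "b = a \<otimes> c"
    proof
      show "b = a \<otimes> (inv a \<otimes> b)"
        by (simp add: m_assoc[symmetric])
    qed simp
    have eq: "(b, g) = (a, g) \<otimes>\<^bsub>extension\<^esub> embed c"
      using c by (simp add: embed_mult)
    then have "embed c = inv\<^bsub>extension\<^esub> (a, g) \<otimes>\<^bsub>extension\<^esub> (b, g)"
      using E.inv_solve_left[of "embed c" "(a, g)" "(b, g)"] i.hom_closed[OF c(1)]
        \<open>a \<in> carrier A\<close> \<open>b \<in> carrier A\<close> by (metis SigmaI UNIV_I extension_simps(1))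
    then have "embed c \<in> R"
      using ab R by (simp add: subgroup.m_closed subgroup.m_inv_closed)
    then have "embed c = \<one>\<^bsub>extension\<^esub>"
      using disj c(1) by blast
    then have "(b, g) = (a, g)"
      using eq E.r_one[of "(a, g)"] by simp
    then show ?thesis
      by simp
  qed
  \<comment> \<open>The product of two points of the graph lies in \<open>R\<close> above
    \<open>f + g\<close>, where \<open>\<gamma> (f + g)\<close> is the only first
    coordinate.\<close>
  have mult: "\<gamma> f \<otimes> \<gamma> g \<otimes> \<phi> f g = \<gamma> (f + g)" for f g
    using subgroup.m_closed[OF R \<gamma> \<gamma>, of f g] unique \<gamma> by simp
  have "\<phi> f g \<otimes> inv \<gamma> (f + g) = inv \<gamma> f \<otimes> inv \<gamma> g" for f g
  proof -
    have "\<phi> f g = inv (\<gamma> f \<otimes> \<gamma> g) \<otimes> \<gamma> (f + g)"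
      by (subst inv_solve_left) (simp_all add: mult)
    then show ?thesis
      by (simp add: inv_mult m_assoc)
  qed
  \<comment> \<open>In \<open>mult\<close> the cocycle stands on the side of
    \<open>\<gamma> f \<otimes> \<gamma> g\<close>, so the bounding function is the pointwise
    inverse of \<open>\<gamma>\<close>.\<close>
  then have "\<phi> \<in> B2 A"
    unfolding B2_iff by (intro conjI allI exI[of _ "\<lambda>g. inv \<gamma> g"]) auto
  then show ?thesis
    unfolding B2_S_def by (intro CollectI conjI allI symmetric)
qed

end

section \<open>The group of symmetric cocycles and its quotient\<close>

text \<open>Identities between products in an abelian group survive pointwise multiplication and
  inversion. The group structure is needed to treat \<open>H2_S\<close> as a factor group.\<close>

lemma (in comm_group) comm_group_Z2_S: "comm_group (Z2_S_group G)"
proof (rule comm_groupI; unfold Z2_S_group_def; simp)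
  show "(\<lambda>f g. \<phi> f g \<otimes> \<psi> f g) \<in> Z2_S G"
    if "\<phi> \<in> Z2_S G" "\<psi> \<in> Z2_S G" for \<phi> \<psi> :: "'h::ab_group_add \<Rightarrow> 'h \<Rightarrow> 'a"
  proof -
    interpret \<phi>: symmetric_cocycle G \<phi>
      using that by unfold_locales
    interpret \<psi>: symmetric_cocycle G \<psi>
      using that by unfold_locales
    have "\<phi> f g \<otimes> \<psi> f g \<otimes> (\<phi> (f + g) h \<otimes> \<psi> (f + g) h)
        = (\<phi> f g \<otimes> \<phi> (f + g) h) \<otimes> (\<psi> f g \<otimes> \<psi> (f + g) h)" for f g h
      by (simp add: m_ac)
    also have "\<dots> f g h = \<phi> g h \<otimes> \<psi> g h \<otimes> (\<phi> f (g + h) \<otimes> \<psi> f (g + h))" for f g h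
      unfolding \<phi>.cocycle \<psi>.cocycle by (simp add: m_ac)
    finally have "(\<lambda>f g. \<phi> f g \<otimes> \<psi> f g) \<in> Z2 G"
      by (simp add: Z2_iff)
    then show ?thesis
      by (simp add: Z2_S_def \<phi>.symmetric \<psi>.symmetric)
  qed
  show "(\<lambda>f g. \<one>) \<in> Z2_S G"
    by (simp add: Z2_S_def Z2_iff)
  show "\<exists>\<psi>\<in>Z2_S G. (\<lambda>f g. \<psi> f g \<otimes> \<phi> f g) = (\<lambda>f g. \<one>)" if "\<phi> \<in> Z2_S G"
    for \<phi> :: "'h::ab_group_add \<Rightarrow> 'h \<Rightarrow> 'a"
  proof -
    interpret \<phi>: symmetric_cocycle G \<phi>
      using that by unfold_locales
    have "inv \<phi> f g \<otimes> inv \<phi> (f + g) h = inv \<phi> g h \<otimes> inv \<phi> f (g + h)" for f g h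
      using \<phi>.cocycle[of f g h] by (simp flip: inv_mult)
    then have "(\<lambda>f g. inv \<phi> f g) \<in> Z2 G"
      by (simp add: Z2_iff)
    then have "(\<lambda>f g. inv \<phi> f g) \<in> Z2_S G"
      by (simp add: Z2_S_def \<phi>.symmetric)
    then show ?thesis
      by (intro bexI[of _ "\<lambda>f g. inv \<phi> f g"]) auto
  qed
  have closed: "\<phi> f g \<in> carrier G" if "\<phi> \<in> Z2_S G" for \<phi> :: "'h::ab_group_add \<Rightarrow> 'h \<Rightarrow> 'a" and f g
    using that by (simp add: Z2_S_def Z2_iff)
  show "(\<lambda>f g. \<phi> f g \<otimes> \<psi> f g \<otimes> \<chi> f g) = (\<lambda>f g. \<phi> f g \<otimes> (\<psi> f g \<otimes> \<chi> f g))"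
    if "\<phi> \<in> Z2_S G" "\<psi> \<in> Z2_S G" "\<chi> \<in> Z2_S G"
    for \<phi> \<psi> \<chi> :: "'h::ab_group_add \<Rightarrow> 'h \<Rightarrow> 'a"
    using that by (simp add: closed m_assoc)
  show "(\<lambda>f g. \<phi> f g \<otimes> \<psi> f g) = (\<lambda>f g. \<psi> f g \<otimes> \<phi> f g)"
    if "\<phi> \<in> Z2_S G" "\<psi> \<in> Z2_S G" for \<phi> \<psi> :: "'h::ab_group_add \<Rightarrow> 'h \<Rightarrow> 'a"
    using closed[OF that(1)] closed[OF that(2)] by (simp add: fun_eq_iff m_comm)
  show "(\<lambda>f g. \<one> \<otimes> \<phi> f g) = \<phi>" if "\<phi> \<in> Z2_S G"
    for \<phi> :: "'h::ab_group_add \<Rightarrow> 'h \<Rightarrow> 'a"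
    using that by (simp add: closed)
qed

text \<open>Every symmetric cocycle is a coboundary, so \<open>B2_S\<close> is the whole of
  \<open>Z2_S\<close> and has a single coset.\<close>

theorem (in comm_group) divisible_imp_trivial_H2_S:
  assumes div: "\<And>(n::nat) a. n > 0 \<Longrightarrow> a \<in> carrier G \<Longrightarrow> \<exists>b\<in>carrier G. b [^] n = a"
  shows "trivial_group (H2_S G :: ('h::ab_group_add \<Rightarrow> 'h \<Rightarrow> 'a) set monoid)"
proof -
  interpret Z: comm_group "Z2_S_group G :: ('h \<Rightarrow> 'h \<Rightarrow> 'a) monoid"
    by (rule comm_group_Z2_S)
  have "\<phi> \<in> B2_S G" if "\<phi> \<in> Z2_S G" for \<phi> :: "'h \<Rightarrow> 'h \<Rightarrow> 'a"
    using div that symmetric_cocycle.divisible_imp_B2_S[of G \<phi>]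
    by (simp add: symmetric_cocycle_def symmetric_cocycle_axioms_def comm_group_axioms)
  moreover have "B2_S G \<subseteq> (Z2_S G :: ('h \<Rightarrow> 'h \<Rightarrow> 'a) set)"
    using B2_subset_Z2 by (auto simp: B2_S_def Z2_S_def)
  ultimately have B2: "B2_S G = carrier (Z2_S_group G :: ('h \<Rightarrow> 'h \<Rightarrow> 'a) monoid)"
    by (auto simp: Z2_S_group_def)
  have "rcosets\<^bsub>Z2_S_group G\<^esub> carrier (Z2_S_group G) = {carrier (Z2_S_group G :: ('h \<Rightarrow> 'h \<Rightarrow> 'a) monoid)}"
    using Z.subgroup_self Z.coset_join2 by (auto simp: RCOSETS_def)
  then show ?thesis
    using normal.factorgroup_is_group[OF Z.normal_self]
    by (simp add: trivial_group_def H2_S_def B2 FactGroup_def)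
qed

section \<open>The unit group of a root-closed field\<close>

lemma field_units_simps [simp]:
  "carrier field_units = - {0}" "x \<otimes>\<^bsub>field_units\<^esub> y = x * y" "\<one>\<^bsub>field_units\<^esub> = 1"
  by (simp_all add: field_units_def)

lemma nat_pow_field_units [simp]: "x [^]\<^bsub>field_units\<^esub> (n::nat) = x ^ n"
  by (induction n) (simp_all add: nat_pow_def mult.commute)

text \<open>A root of a nonzero element for a positive exponent is nonzero, so taking roots in the
  field does not leave the unit group.\<close>

lemma root_closed_imp_divisible_field_units:
  fixes a :: "'k::field"
  assumes "root_closed TYPE('k)" "n > 0" "a \<in> carrier field_units"
  shows "\<exists>b\<in>carrier field_units. b [^]\<^bsub>field_units\<^esub> (n::nat) = a"
proof -
  obtain y where "y ^ n = a"
    using assms(1,2) unfolding root_closed_def by (metis One_nat_def Suc_leI)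
  moreover from this have "y \<noteq> 0"
    using assms(2,3) by auto
  ultimately show ?thesis
    by auto
qed

lemma trivial_H2_S_field_units:
  assumes "root_closed TYPE('k::field)"
  shows "trivial_group (H2_S field_units :: ('g::ab_group_add \<Rightarrow> 'g \<Rightarrow> 'k) set monoid)"
  using comm_group_field_units root_closed_imp_divisible_field_units[OF assms]
  by (rule comm_group.divisible_imp_trivial_H2_S)

lemma root_closed_alg_closed_field: "root_closed TYPE('c::alg_closed_field)"
  unfolding root_closed_def using nth_root_exists by (metis less_eq_Suc_le One_nat_def)

section \<open>Graded fields: one-dimensional components and a multiplicative section\<close>

context graded_field
begin

lemma embed_zero [simp]: "\<iota> 0 = 0"
  using embed_add[of 0 0] by simp

lemma embed_uminus: "\<iota> (- a) = - \<iota> a"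
  using embed_add[of a "- a"] by (simp add: eq_neg_iff_add_eq_0 add.commute)

lemma embed_diff: "\<iota> (a - b) = \<iota> a - \<iota> b"
  using embed_add[of a "- b"] by (simp add: embed_uminus)

lemma embed_mem: "\<iota> a \<in> F 0"
  using range_embed by blast

lemma embed_mult_mem: "x \<in> F g \<Longrightarrow> \<iota> a * x \<in> F g"
  using mult_mem[OF embed_mem, of x g a] by simp

text \<open>A nonzero scalar is invertible in \<open>'f\<close>, hence can be cancelled although
  \<open>'f\<close> is only known to be a commutative ring.\<close>

lemma embed_mult_eq_zero_iff:
  assumes "x \<in> F g" "x \<noteq> 0"
  shows "\<iota> a * x = 0 \<longleftrightarrow> a = 0"
proof
  assume 0: "\<iota> a * x = 0"
  show "a = 0"
  proof (rule ccontr)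
    assume "a \<noteq> 0"
    then have "\<iota> (inverse a) * \<iota> a = 1"
      by (simp add: embed_one flip: embed_mult)
    then have "x = \<iota> (inverse a) * (\<iota> a * x)"
      by (simp add: mult.assoc[symmetric])
    then show False
      using 0 assms(2) by simp
  qed
qed simp

lemma embed_mult_cancel:
  assumes "x \<in> F g" "x \<noteq> 0"
  shows "\<iota> a * x = \<iota> b * x \<longleftrightarrow> a = b"
  using embed_mult_eq_zero_iff[OF assms, of "a - b"] by (simp add: embed_diff left_diff_distrib)

lemma homogeneous_mult_nonzero:
  assumes "x \<in> F g" "x \<noteq> 0" "y \<noteq> 0"
  shows "x * y \<noteq> 0"
proof
  assume "x * y = 0"
  moreover obtain z where "x * z = 1"
    using homogeneous_invertible assms by blast
  then have "y = z * (x * y)"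
    by (metis mult.assoc mult.commute mult_1)
  ultimately show False
    using assms(3) by simp
qed

lemma nonzero_homogeneous: "\<exists>x\<in>F g. x \<noteq> 0"
  using nonzero_component zero_mem by blast

text \<open>A nonzero \<open>z\<close> of degree \<open>- g\<close> moves \<open>x\<close> and
  \<open>y\<close> into degree 0, that is into the field, where their quotient can be formed. Each
  component is thus a line.\<close>

lemma component_generator:
  assumes x: "x \<in> F g" "x \<noteq> 0" and y: "y \<in> F g"
  shows "\<exists>a. y = \<iota> a * x"
proof -
  obtain z where z: "z \<in> F (- g)" "z \<noteq> 0"
    using nonzero_homogeneous by blast
  have "x * z \<in> F 0" "y * z \<in> F 0"
    using mult_mem[OF x(1) z(1)] mult_mem[OF y z(1)] by simp_all
  then obtain b c where b: "x * z = \<iota> b" and c: "y * z = \<iota> c"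
    using range_embed by blast
  have "b \<noteq> 0"
    using homogeneous_mult_nonzero[OF x z(2)] b by auto
  then have "\<iota> (inverse b) * \<iota> b = 1"
    by (simp add: embed_one flip: embed_mult)
  then have "y = y * (\<iota> (inverse b) * (x * z))"
    using b by simp
  also have "\<dots> = \<iota> (c * inverse b) * x"
    by (simp add: embed_mult mult_ac flip: c)
  finally show ?thesis ..
qed

text \<open>Associativity and commutativity in \<open>'f\<close> make the structure constants of
  arbitrary generators a symmetric cocycle, which bounds because the units are divisible. The
  resulting \<open>s\<close> is a homomorphism into the homogeneous units.\<close>

lemma multiplicative_section:
  assumes "root_closed TYPE('k)"
  obtains s where "\<And>g. s g \<in> F g" "\<And>g. s g \<noteq> 0" "\<And>f g. s f * s g = s (f + g)" "s 0 = 1"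
proof -
  interpret U: comm_group "field_units :: 'k monoid"
    by (rule comm_group_field_units)
  obtain u where u: "\<And>g. u g \<in> F g" "\<And>g. u g \<noteq> 0"
    using nonzero_homogeneous by metis
  have "\<exists>a. u f * u g = \<iota> a * u (f + g)" for f g
    using component_generator u mult_mem by blast
  then obtain \<phi> where \<phi>: "\<And>f g. u f * u g = \<iota> (\<phi> f g) * u (f + g)"
    by metis
  have nz: "\<phi> f g \<noteq> 0" for f g
    using \<phi>[of f g] homogeneous_mult_nonzero[OF u(1) u(2) u(2), of f g] by auto
  \<comment> \<open>Both sides are the coefficient at \<open>u (f + g + h)\<close> of the product of
    \<open>u f\<close>, \<open>u g\<close> and \<open>u h\<close>, computed with the two
    bracketings.\<close>
  have "\<phi> f g * \<phi> (f + g) h = \<phi> g h * \<phi> f (g + h)" for f g h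
  proof -
    have "\<iota> (\<phi> f g * \<phi> (f + g) h) * u (f + g + h) = \<iota> (\<phi> f g) * (u (f + g) * u h)"
      by (simp only: \<phi>[of "f + g" h] embed_mult mult.assoc)
    also have "\<dots> = u f * u g * u h"
      by (simp only: \<phi>[of f g] mult.assoc)
    also have "\<dots> = u f * (u g * u h)"
      by (rule mult.assoc)
    also have "\<dots> = \<iota> (\<phi> g h) * (u f * u (g + h))"
      by (simp only: \<phi>[of g h] mult_ac)
    also have "\<dots> = \<iota> (\<phi> g h * \<phi> f (g + h)) * u (f + g + h)"
      by (simp only: \<phi>[of f "g + h"] embed_mult add.assoc mult.assoc)
    finally show ?thesis
      using embed_mult_cancel[OF u] by simp
  qed
  then have "\<phi> \<in> Z2 field_units"
    unfolding U.Z2_iff using nz by simp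
  moreover have "\<phi> f g = \<phi> g f" for f g
    using \<phi>[of f g] \<phi>[of g f] embed_mult_cancel[OF u, of _ "f + g"]
    by (simp add: mult.commute add.commute)
  ultimately have "\<phi> \<in> Z2_S field_units"
    unfolding Z2_S_def by blast
  then interpret C: symmetric_cocycle field_units \<phi>
    by unfold_locales
  have "\<phi> \<in> B2_S field_units"
    using root_closed_imp_divisible_field_units[OF assms] by (rule C.divisible_imp_B2_S)
  then obtain \<beta> where \<beta>: "\<And>g. \<beta> g \<noteq> 0" "\<And>f g. \<phi> f g * \<beta> (f + g) = \<beta> f * \<beta> g"
    unfolding B2_S_def U.B2_iff by auto
  \<comment> \<open>The structure constant is
    \<open>\<beta> f * \<beta> g / \<beta> (f + g)\<close>, so dividing each generator by its
    \<open>\<beta>\<close> absorbs it.\<close>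
  define s where "s g = \<iota> (inverse (\<beta> g)) * u g" for g
  have mult: "s f * s g = s (f + g)" for f g
  proof -
    have "inverse (\<beta> f) * inverse (\<beta> g) * \<phi> f g = inverse (\<beta> (f + g))"
      using \<beta>(1) \<beta>(2)[of f g] by (simp add: field_simps)
    then have "\<iota> (inverse (\<beta> f)) * \<iota> (inverse (\<beta> g)) * \<iota> (\<phi> f g) = \<iota> (inverse (\<beta> (f + g)))"
      by (metis embed_mult)
    moreover have "s f * s g = \<iota> (inverse (\<beta> f)) * \<iota> (inverse (\<beta> g)) * (u f * u g)"
      by (simp add: s_def mult_ac)
    ultimately show ?thesis
      by (simp add: \<phi> s_def mult.assoc[symmetric])
  qed
  have mem: "s g \<in> F g" "s g \<noteq> 0" for g
    using embed_mult_mem u embed_mult_eq_zero_iff[OF u] \<beta>(1) by (auto simp: s_def)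
  \<comment> \<open>By \<open>mult\<close>, \<open>s 0\<close> is idempotent; being invertible it is
    1.\<close>
  obtain z where "s 0 * z = 1"
    using homogeneous_invertible mem by blast
  then have "s 0 = 1"
    using mult[of 0 0] by (metis add_0 mult.assoc mult_1_right)
  then show thesis
    using that mem mult by blast
qed

section \<open>The isomorphism with the group algebra\<close>

text \<open>The linear extension of the section is bijective because each component is the line
  through \<open>s g\<close> and the ring is the direct sum of these lines.\<close>

lemma isomorphic_group_algebra:
  assumes "root_closed TYPE('k)"
  shows "graded_algebra_isomorphic F \<iota> group_algebra_component
    (group_algebra_embed :: 'k \<Rightarrow> ('g \<Rightarrow>\<^sub>0 'k))"
proof -
  obtain s where s: "\<And>g. s g \<in> F g" "\<And>g. s g \<noteq> 0"
    and s_mult: "\<And>f g. s f * s g = s (f + g)" and s_0: "s 0 = 1"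
    using multiplicative_section[OF assms] by blast
  define \<psi> :: "('g \<Rightarrow>\<^sub>0 'k) \<Rightarrow> 'f"
    where "\<psi> p = (\<Sum>g\<in>Poly_Mapping.keys p. \<iota> (Poly_Mapping.lookup p g) * s g)" for p
  \<comment> \<open>Allows sums over a common finite index set, since the keys of a sum may be fewer
    than the union of the keys.\<close>
  have superset: "\<psi> p = (\<Sum>g\<in>S. \<iota> (Poly_Mapping.lookup p g) * s g)"
    if "finite S" "Poly_Mapping.keys p \<subseteq> S" for p S
    unfolding \<psi>_def using that by (intro sum.mono_neutral_left) (auto simp: in_keys_iff)
  have add: "\<psi> (p + q) = \<psi> p + \<psi> q" for p q
  proof -
    let ?S = "Poly_Mapping.keys p \<union> Poly_Mapping.keys q"
    have "Poly_Mapping.keys (p + q) \<subseteq> ?S"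
      by (rule Poly_Mapping.keys_add)
    then show ?thesis
      by (simp add: superset[of ?S] lookup_add embed_add distrib_right sum.distrib)
  qed
  have zero: "\<psi> 0 = 0"
    by (simp add: \<psi>_def)
  have sum: "\<psi> (\<Sum>i\<in>I. p i) = (\<Sum>i\<in>I. \<psi> (p i))" for I :: "'g set" and p
    by (induction I rule: infinite_finite_induct) (simp_all add: add zero)
  have single: "\<psi> (Poly_Mapping.single g a) = \<iota> a * s g" for g a
    by (subst superset[of "{g}"]) (auto simp: in_keys_iff lookup_single when_def)
  have expand: "p = (\<Sum>g\<in>Poly_Mapping.keys p. Poly_Mapping.single g (Poly_Mapping.lookup p g))"
    for p :: "'g \<Rightarrow>\<^sub>0 'k"
    by (rule poly_mapping_eqI) (simp add: lookup_sum lookup_single when_def in_keys_iff)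
  have mult_single: "\<psi> (Poly_Mapping.single g a * Poly_Mapping.single h b)
      = \<psi> (Poly_Mapping.single g a) * \<psi> (Poly_Mapping.single h b)" for g h a b
  proof -
    have "\<iota> (a * b) * s (g + h) = \<iota> a * \<iota> b * (s g * s h)"
      by (simp add: embed_mult s_mult)
    then show ?thesis
      by (simp add: mult_single single mult_ac)
  qed
  have mult: "\<psi> (p * q) = \<psi> p * \<psi> q" for p q
  proof -
    \<comment> \<open>Expanding both factors into monomials reduces multiplicativity to
      \<open>mult_single\<close>.\<close>
    let ?m = "\<lambda>p g. Poly_Mapping.single g (Poly_Mapping.lookup p g)"
    have "p * q = (\<Sum>g\<in>Poly_Mapping.keys p. \<Sum>h\<in>Poly_Mapping.keys q. ?m p g * ?m q h)"
      using arg_cong2[OF expand expand, of times p q] by (simp only: sum_product)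
    then have "\<psi> (p * q) = (\<Sum>g\<in>Poly_Mapping.keys p. \<psi> (?m p g)) * (\<Sum>h\<in>Poly_Mapping.keys q. \<psi> (?m q h))"
      by (simp only: sum mult_single sum_product)
    also have "\<dots> = \<psi> p * \<psi> q"
      by (simp only: single \<psi>_def[of p] \<psi>_def[of q])
    finally show ?thesis .
  qed
  have bij: "bij \<psi>"
  proof (rule bijI)
    show "inj \<psi>"
    proof (rule injI)
      fix p q assume eq: "\<psi> p = \<psi> q"
      \<comment> \<open>For \<open>p\<close> and \<open>q\<close> these families are homogeneous
        decompositions of the same element, so they coincide by the uniqueness in
        \<open>direct_sum\<close>; the scalars can be compared because \<open>s g\<close> is
        nonzero.\<close>
      let ?c = "\<lambda>p g. \<iota> (Poly_Mapping.lookup p g) * s g"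
      have supp: "{g. ?c p g \<noteq> 0} = Poly_Mapping.keys p" for p
        by (auto simp: embed_mult_eq_zero_iff[OF s] in_keys_iff)
      have P: "(\<forall>g. ?c p g \<in> F g) \<and> finite {g. ?c p g \<noteq> 0} \<and> \<psi> p = (\<Sum>g | ?c p g \<noteq> 0. ?c p g)" for p
        unfolding supp by (simp add: \<psi>_def embed_mult_mem s)
      obtain c where c: "\<And>c'. (\<forall>g. c' g \<in> F g) \<and> finite {g. c' g \<noteq> 0} \<and>
          \<psi> p = (\<Sum>g | c' g \<noteq> 0. c' g) \<Longrightarrow> c' = c"
        using direct_sum[of "\<psi> p"] by (elim ex1E) blast
      have "?c p = c"
        by (rule c) (rule P)
      moreover have "?c q = c"
        by (rule c, unfold eq) (rule P)
      ultimately have "?c p g = ?c q g" for g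
        by metis
      then show "p = q"
        by (intro poly_mapping_eqI) (metis embed_mult_cancel s)
    qed
    have "\<exists>p. x = \<psi> p" for x
    proof -
      obtain c where c: "\<And>g. c g \<in> F g" "x = (\<Sum>g | c g \<noteq> 0. c g)"
        using direct_sum[of x] by blast
      obtain a where "\<And>g. c g = \<iota> (a g) * s g"
        using component_generator[OF s c(1)] by metis
      then have "x = \<psi> (\<Sum>g | c g \<noteq> 0. Poly_Mapping.single g (a g))"
        using c(2) by (simp add: sum single)
      then show ?thesis ..
    qed
    then show "surj \<psi>"
      by (auto simp: surj_def)
  qed
  have image: "\<psi> ` group_algebra_component g = F g" for g
  proof -
    have "\<psi> ` group_algebra_component g = (\<lambda>a. \<iota> a * s g) ` UNIV"
      by (auto simp: group_algebra_component_def image_image single)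
    also have "\<dots> = F g"
      using component_generator[OF s] embed_mult_mem[OF s(1)] by blast
    finally show ?thesis .
  qed
  \<comment> \<open>The required isomorphism starts at the graded field, so the inverse of
    \<open>\<psi>\<close> is used.\<close>
  define \<theta> where "\<theta> = inv_into UNIV \<psi>"
  have inv: "\<theta> (\<psi> p) = p" "\<psi> (\<theta> x) = x" for p x
    using bij by (simp_all add: bij_is_inj bij_is_surj surj_f_inv_f \<theta>_def)
  have "graded_algebra_iso F \<iota> group_algebra_component
      (group_algebra_embed :: 'k \<Rightarrow> ('g \<Rightarrow>\<^sub>0 'k)) \<theta>"
    unfolding graded_algebra_iso_def
  proof (intro conjI allI)
    show "bij \<theta>"
      unfolding \<theta>_def using bij by (rule bij_imp_bij_inv)
    show "\<theta> (x + y) = \<theta> x + \<theta> y" for x y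
      using add[of "\<theta> x" "\<theta> y"] inv by metis
    show "\<theta> (x * y) = \<theta> x * \<theta> y" for x y
      using mult[of "\<theta> x" "\<theta> y"] inv by metis
    \<comment> \<open>The normalisation \<open>s 0 = 1\<close> makes \<open>\<psi>\<close> send the
      constant \<open>a\<close> to \<open>\<iota> a\<close>.\<close>
    show emb: "\<theta> (\<iota> a) = group_algebra_embed a" for a
      using single[of 0 a] inv(1) by (metis group_algebra_embed_def mult_1_right s_0)
    show "\<theta> 1 = 1"
      using emb[of 1] by (simp add: embed_one group_algebra_embed_def)
    show "\<theta> ` F g = group_algebra_component g" for g
      unfolding image[symmetric] by (simp add: image_image inv)
  qed
  then show ?thesis
    unfolding graded_algebra_isomorphic_def by blast
qed

end

text \<open>The two equivalent claims are both asserted. Algebraic closedness is a type class while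
  root-closedness is a predicate, so the last claim has its own field type
  \<open>'c\<close>.\<close>

theorem theorem5p18:
  fixes d :: nat
  assumes "torsion_free TYPE('g::ab_group_add)"
    and "has_finite_rank TYPE('g)"
    and "group_rank TYPE('g) = d"
  shows
    "(root_closed TYPE('k::field) \<longrightarrow>
        (\<forall>(F :: 'g \<Rightarrow> 'f::comm_ring_1 set) (\<iota> :: 'k \<Rightarrow> 'f).
           graded_field F \<iota> \<longrightarrow>
           graded_algebra_isomorphic F \<iota> group_algebra_component
             (group_algebra_embed :: 'k \<Rightarrow> ('g \<Rightarrow>\<^sub>0 'k))) \<and>
        trivial_group (H2_S field_units :: ('g \<Rightarrow> 'g \<Rightarrow> 'k) set monoid)) \<and>
     ((\<forall>(F :: 'g \<Rightarrow> 'f set) (\<iota> :: 'c::alg_closed_field \<Rightarrow> 'f).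
         graded_field F \<iota> \<longrightarrow>
         graded_algebra_isomorphic F \<iota> group_algebra_component
           (group_algebra_embed :: 'c \<Rightarrow> ('g \<Rightarrow>\<^sub>0 'c))) \<and>
      trivial_group (H2_S field_units :: ('g \<Rightarrow> 'g \<Rightarrow> 'c) set monoid))"
proof (intro conjI impI allI)
  show "trivial_group (H2_S field_units :: ('g \<Rightarrow> 'g \<Rightarrow> 'k) set monoid)"
    if "root_closed TYPE('k)"
    using that by (rule trivial_H2_S_field_units)
  show "trivial_group (H2_S field_units :: ('g \<Rightarrow> 'g \<Rightarrow> 'c) set monoid)"
    using root_closed_alg_closed_field by (rule trivial_H2_S_field_units)
qed (simp_all add: graded_field.isomorphic_group_algebra root_closed_alg_closed_field)

end
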